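(* Let $\Gamma$ be a set and let $X$ be a solid Banach lattice of real functions on $\Gamma$ with $\|e_\gamma\|=1$ for every $\gamma\in\Gamma$. If there exists $\alpha\in\Gamma$ such that $X$ is uniformly strictly monotone at $\alpha$, then $X$ fails to have the local diameter two property.
   Context: All spaces are real. A solid Banach lattice of real functions on a set $\Gamma$ is a Banach space $(X,\|\cdot\|)$ consisting of bounded functions $x:\Gamma\to\mathbb{R}$ such that: (1) if $x\in X$ and $y:\Gamma\to\mathbb{R}$ satisfies $|y(\gamma)|\le|x(\gamma)|$ for all $\gamma\in\Gamma$, then $y\in X$ and $\|y\|\le\|x\|$; (2) for every $\alpha\in\Gamma$ the function $e_\alpha$ with $e_\alpha(\alpha)=1$ and $e_\alpha(\gamma)=0$ for $\gamma\ne\alpha$ belongs to $X$. For $\gamma\in\Gamma$, $e_\gamma^*\in X^*$ is the functional $e_\gamma^*(x)=x(\gamma)$. $B_X$ and $S_X$ denote the closed unit ball and the unit sphere of $X$. For $\alpha\in\Gamma$ and $\varepsilon>0$ put $$E_\alpha(\varepsilon):=\sup\{\|x-e_\alpha^*(x)e_\alpha\| : x\in S_X,\ e_\alpha^*(x)>1-\varepsilon\}.$$ $X$ is uniformly strictly monotone at $\alpha\in\Gamma$ if there exists $\varepsilon>0$ such that $E_\alpha(\varepsilon)<1$. A slice of $B_X$ is a set $S(x^*,\varepsilon)=\{x\in B_X: x^*(x)>1-\varepsilon\}$ with $x^*\in S_{X^*}$ and $\varepsilon>0$. $X$ has the local diameter two property (LD2P) if every slice of $B_X$ has diameter two. *)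

theory Defs
  imports "HOL-Analysis.Analysis"
begin

text \<open>
  A Banach space consisting of real functions on a set is rendered as a type \<^typ>\<open>'a\<close> of class
  \<^class>\<open>banach\<close> together with an injective map \<open>ev\<close> that sends every element of the space to the
  function on \<^typ>\<open>'g\<close> it stands for; linearity of every coordinate says that the vector space
  operations are the pointwise ones. The set of functions is \<open>range ev\<close>, and the functional
  \<open>e\<^sub>\<gamma>\<^sup>*\<close> is \<open>\<lambda>x. ev x \<gamma>\<close>.
\<close>

locale solid_banach_lattice =
  fixes ev :: "'a::banach \<Rightarrow> 'g \<Rightarrow> real"
  assumes inj_ev: "inj ev"
    and linear_ev: "\<And>\<gamma>. linear (\<lambda>x. ev x \<gamma>)"
    and bounded_ev: "\<And>x. bounded (range (ev x))"
    and solid: "\<And>x y. (\<And>\<gamma>. \<bar>y \<gamma>\<bar> \<le> \<bar>ev x \<gamma>\<bar>) \<Longrightarrow> \<exists>z. ev z = y \<and> norm z \<le> norm x"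
    and unit_in_range: "\<And>\<alpha>. (\<lambda>\<gamma>. if \<gamma> = \<alpha> then 1 else 0) \<in> range ev"

definition unit_fun :: "('a \<Rightarrow> 'g \<Rightarrow> real) \<Rightarrow> 'g \<Rightarrow> 'a"
  where "unit_fun ev \<alpha> = (THE x. ev x = (\<lambda>\<gamma>. if \<gamma> = \<alpha> then 1 else 0))"

text \<open>
  If the unit functions have norm one, then for \<open>\<epsilon> > 0\<close> the set below contains 0 (from
  \<open>x = unit_fun ev \<alpha>\<close>) and, by solidity, is bounded above by 1, so the supremum in the reals is
  the intended one.
\<close>

definition E_modulus :: "('a::real_normed_vector \<Rightarrow> 'g \<Rightarrow> real) \<Rightarrow> 'g \<Rightarrow> real \<Rightarrow> real"
  where "E_modulus ev \<alpha> \<epsilon> =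
    Sup {norm (x - ev x \<alpha> *\<^sub>R unit_fun ev \<alpha>) | x. x \<in> sphere 0 1 \<and> ev x \<alpha> > 1 - \<epsilon>}"

definition uniformly_strictly_monotone_at :: "('a::real_normed_vector \<Rightarrow> 'g \<Rightarrow> real) \<Rightarrow> 'g \<Rightarrow> bool"
  where "uniformly_strictly_monotone_at ev \<alpha> \<longleftrightarrow> (\<exists>\<epsilon>>0. E_modulus ev \<alpha> \<epsilon> < 1)"

definition slice :: "('a::real_normed_vector \<Rightarrow>\<^sub>L real) \<Rightarrow> real \<Rightarrow> 'a set"
  where "slice f \<epsilon> = {x \<in> cball 0 1. blinfun_apply f x > 1 - \<epsilon>}"

definition LD2P :: "'a::real_normed_vector itself \<Rightarrow> bool"
  where "LD2P _ \<longleftrightarrow>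
    (\<forall>(f :: 'a \<Rightarrow>\<^sub>L real) \<epsilon>. norm f = 1 \<longrightarrow> \<epsilon> > 0 \<longrightarrow> diameter (slice f \<epsilon>) = 2)"

end

theory Submission
  imports Defs
begin

text \<open>
  The coordinate functional at a point \<open>\<alpha>\<close> of uniform strict monotonicity defines a slice of
  diameter less than two. By solidity this functional has norm one, and an element \<open>x\<close> of the unit
  ball splits as \<open>x = x(\<alpha>) e\<^sub>\<alpha> + (x - x(\<alpha>) e\<^sub>\<alpha>)\<close>. When \<open>x(\<alpha>) > 1 - \<delta>\<close> with
  \<open>\<delta> \<le> \<epsilon>\<close> and \<open>\<delta> \<le> 1\<close>, the second part has norm at most \<open>E = E\<^sub>\<alpha>(\<epsilon>) < 1\<close>: normalising \<open>x\<close> does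
  not decrease its positive value at \<open>\<alpha>\<close>, so the supremum over the sphere controls the ball as
  well (\<open>norm_remove_coordinate_le_E_modulus_cball\<close>). Hence two elements of the slice with
  parameter \<open>\<delta>\<close> differ by at most \<open>\<delta>\<close> in the direction of \<open>e\<^sub>\<alpha>\<close> and by at most \<open>2 E\<close> in the
  complementary part (\<open>diameter_coordinate_slice_le\<close>). With \<open>\<delta> \<le> 1 - E\<close> the diameter is at
  most \<open>1 + E < 2\<close>.
\<close>

context solid_banach_lattice
begin

lemma ev_scaleR: "ev (c *\<^sub>R x) \<gamma> = c * ev x \<gamma>"
  using linear_scale[OF linear_ev] by simp

lemma ev_diff: "ev (x - y) \<gamma> = ev x \<gamma> - ev y \<gamma>"
  using linear_diff[OF linear_ev] .

lemma ev_unit_fun: "ev (unit_fun ev \<alpha>) = (\<lambda>\<gamma>. if \<gamma> = \<alpha> then 1 else 0)"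
proof -
  obtain x where x: "ev x = (\<lambda>\<gamma>. if \<gamma> = \<alpha> then 1 else 0)"
    using unit_in_range[of \<alpha>] by (auto simp: image_iff)
  show ?thesis
    unfolding unit_fun_def
    by (rule theI[where a = x]) (simp_all add: x inj_eq[OF inj_ev] flip: x)
qed

text \<open>
  Solidity only provides an element that represents the dominated function; injectivity
  identifies it with the element at hand.
\<close>

lemma norm_mono:
  assumes "\<And>\<gamma>. \<bar>ev y \<gamma>\<bar> \<le> \<bar>ev x \<gamma>\<bar>"
  shows "norm y \<le> norm x"
proof -
  obtain z where "ev z = ev y" "norm z \<le> norm x"
    using solid[OF assms] by blast
  then show ?thesis
    by (simp add: inj_eq[OF inj_ev])
qed

lemma norm_remove_coordinate_le: "norm (x - ev x \<alpha> *\<^sub>R unit_fun ev \<alpha>) \<le> norm x"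
  by (rule norm_mono) (simp add: ev_diff ev_scaleR ev_unit_fun)

lemma abs_ev_le_norm:
  assumes "norm (unit_fun ev \<alpha>) = 1"
  shows "\<bar>ev x \<alpha>\<bar> \<le> norm x"
proof -
  have "norm (ev x \<alpha> *\<^sub>R unit_fun ev \<alpha>) \<le> norm x"
    by (rule norm_mono) (simp add: ev_scaleR ev_unit_fun)
  then show ?thesis using assms by simp
qed

lemma bounded_linear_ev:
  assumes "norm (unit_fun ev \<alpha>) = 1"
  shows "bounded_linear (\<lambda>x. ev x \<alpha>)"
  using linear_ev abs_ev_le_norm[OF assms]
  by (intro bounded_linear.intro bounded_linear_axioms.intro exI[of _ 1]) auto

lemma norm_coordinate_functional:
  assumes "norm (unit_fun ev \<alpha>) = 1"
  shows "norm (Blinfun (\<lambda>x. ev x \<alpha>)) = 1"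
proof (rule antisym)
  let ?f = "Blinfun (\<lambda>x. ev x \<alpha>)"
  have f: "blinfun_apply ?f x = ev x \<alpha>" for x
    by (simp add: bounded_linear_Blinfun_apply bounded_linear_ev[OF assms])
  show "norm ?f \<le> 1"
    by (rule norm_blinfun_bound) (use f abs_ev_le_norm[OF assms] in auto)
  show "1 \<le> norm ?f"
    using norm_blinfun[of ?f "unit_fun ev \<alpha>"] by (simp add: f ev_unit_fun assms)
qed

lemma norm_remove_coordinate_le_E_modulus:
  assumes "norm x = 1" and "ev x \<alpha> > 1 - \<epsilon>"
  shows "norm (x - ev x \<alpha> *\<^sub>R unit_fun ev \<alpha>) \<le> E_modulus ev \<alpha> \<epsilon>"
  unfolding E_modulus_def
proof (rule cSup_upper)
  show "bdd_above {norm (x - ev x \<alpha> *\<^sub>R unit_fun ev \<alpha>) |x. x \<in> sphere 0 1 \<and> 1 - \<epsilon> < ev x \<alpha>}"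
    by (rule bdd_aboveI[of _ 1], clarsimp, rule order_trans[OF norm_remove_coordinate_le]) simp
qed (use assms in auto)

lemma E_modulus_nonneg:
  assumes "norm (unit_fun ev \<alpha>) = 1" and "\<epsilon> > 0"
  shows "0 \<le> E_modulus ev \<alpha> \<epsilon>"
  using norm_remove_coordinate_le_E_modulus[of "unit_fun ev \<alpha>" \<epsilon> \<alpha>] assms
  by (simp add: ev_unit_fun)

text \<open>
  The bound for the normalised element gives the one for \<open>x\<close>, since removing the coordinate is
  homogeneous and \<open>norm x \<le> 1\<close>. Normalising does not decrease the value at \<open>\<alpha>\<close> as long as that
  value is nonnegative, which \<open>\<delta> \<le> 1\<close> guarantees.
\<close>

lemma norm_remove_coordinate_le_E_modulus_cball:
  assumes unit: "norm (unit_fun ev \<alpha>) = 1"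
    and "\<delta> \<le> \<epsilon>" "\<delta> \<le> 1"
    and x: "norm x \<le> 1" "ev x \<alpha> > 1 - \<delta>"
  shows "norm (x - ev x \<alpha> *\<^sub>R unit_fun ev \<alpha>) \<le> E_modulus ev \<alpha> \<epsilon>"
proof -
  have pos: "norm x > 0"
    using abs_ev_le_norm[OF unit, of x] assms by linarith
  define u where "u = x /\<^sub>R norm x"
  have "ev x \<alpha> * norm x \<le> ev x \<alpha>"
    using assms by (intro mult_left_le) auto
  then have "ev x \<alpha> \<le> ev u \<alpha>"
    using pos by (simp add: u_def ev_scaleR field_simps)
  then have u: "norm (u - ev u \<alpha> *\<^sub>R unit_fun ev \<alpha>) \<le> E_modulus ev \<alpha> \<epsilon>"
    using assms pos by (intro norm_remove_coordinate_le_E_modulus) (auto simp: u_def)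
  have "x - ev x \<alpha> *\<^sub>R unit_fun ev \<alpha> = norm x *\<^sub>R (u - ev u \<alpha> *\<^sub>R unit_fun ev \<alpha>)"
    using pos by (simp add: u_def ev_scaleR scaleR_diff_right)
  then have "norm (x - ev x \<alpha> *\<^sub>R unit_fun ev \<alpha>)
      = norm x * norm (u - ev u \<alpha> *\<^sub>R unit_fun ev \<alpha>)"
    by simp
  also have "\<dots> \<le> norm (u - ev u \<alpha> *\<^sub>R unit_fun ev \<alpha>)"
    using x by (intro mult_left_le_one_le) auto
  finally show ?thesis using u by linarith
qed

lemma diameter_coordinate_slice_le:
  assumes unit: "norm (unit_fun ev \<alpha>) = 1"
    and "0 < \<delta>" "\<delta> \<le> \<epsilon>" "\<delta> \<le> 1"
  shows "diameter (slice (Blinfun (\<lambda>x. ev x \<alpha>)) \<delta>) \<le> \<delta> + 2 * E_modulus ev \<alpha> \<epsilon>"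
proof (rule diameter_le)
  let ?e = "unit_fun ev \<alpha>" and ?E = "E_modulus ev \<alpha> \<epsilon>"
  let ?S = "slice (Blinfun (\<lambda>x. ev x \<alpha>)) \<delta>"
  show "?S \<noteq> {} \<or> 0 \<le> \<delta> + 2 * ?E"
    using E_modulus_nonneg[OF unit, of \<epsilon>] \<open>0 < \<delta>\<close> \<open>\<delta> \<le> \<epsilon>\<close> by simp
  fix x y assume "x \<in> ?S" "y \<in> ?S"
  then have x: "norm x \<le> 1" "ev x \<alpha> > 1 - \<delta>" and y: "norm y \<le> 1" "ev y \<alpha> > 1 - \<delta>"
    by (simp_all add: slice_def bounded_linear_Blinfun_apply bounded_linear_ev[OF unit])
  have rest: "norm (x - ev x \<alpha> *\<^sub>R ?e) \<le> ?E" "norm (y - ev y \<alpha> *\<^sub>R ?e) \<le> ?E"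
    using norm_remove_coordinate_le_E_modulus_cball[OF unit \<open>\<delta> \<le> \<epsilon>\<close> \<open>\<delta> \<le> 1\<close>] x y by blast+
  have coord: "\<bar>ev x \<alpha> - ev y \<alpha>\<bar> \<le> \<delta>"
    using x y abs_ev_le_norm[OF unit, of x] abs_ev_le_norm[OF unit, of y] by linarith
  have "x - y = (ev x \<alpha> - ev y \<alpha>) *\<^sub>R ?e + ((x - ev x \<alpha> *\<^sub>R ?e) - (y - ev y \<alpha> *\<^sub>R ?e))"
    by (simp add: algebra_simps)
  then have "norm (x - y) \<le> norm ((ev x \<alpha> - ev y \<alpha>) *\<^sub>R ?e)
      + norm ((x - ev x \<alpha> *\<^sub>R ?e) - (y - ev y \<alpha> *\<^sub>R ?e))"
    by (simp only: norm_triangle_ineq)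
  also have "\<dots> \<le> \<bar>ev x \<alpha> - ev y \<alpha>\<bar> + (norm (x - ev x \<alpha> *\<^sub>R ?e) + norm (y - ev y \<alpha> *\<^sub>R ?e))"
    using norm_triangle_ineq4[of "x - ev x \<alpha> *\<^sub>R ?e" "y - ev y \<alpha> *\<^sub>R ?e"] by (simp add: unit)
  finally show "norm (x - y) \<le> \<delta> + 2 * ?E"
    using rest coord by linarith
qed

end

theorem proposition3p2:
  fixes ev :: "'a::banach \<Rightarrow> 'g \<Rightarrow> real"
  assumes "solid_banach_lattice ev"
    and "\<And>\<gamma>. norm (unit_fun ev \<gamma>) = 1"
    and "\<exists>\<alpha>. uniformly_strictly_monotone_at ev \<alpha>"
  shows "\<not> LD2P TYPE('a)"
proof
  assume LD2P: "LD2P TYPE('a)"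
  interpret solid_banach_lattice ev by fact
  obtain \<alpha> \<epsilon> where \<epsilon>: "\<epsilon> > 0" and E: "E_modulus ev \<alpha> \<epsilon> < 1"
    using assms(3) unfolding uniformly_strictly_monotone_at_def by blast
  define \<delta> where "\<delta> = min \<epsilon> (1 - E_modulus ev \<alpha> \<epsilon>)"
  have \<delta>: "0 < \<delta>" "\<delta> \<le> \<epsilon>" "\<delta> \<le> 1 - E_modulus ev \<alpha> \<epsilon>" "\<delta> \<le> 1"
    using \<epsilon> E E_modulus_nonneg[OF assms(2) \<epsilon>, of \<alpha>] by (auto simp: \<delta>_def)
  let ?f = "Blinfun (\<lambda>x. ev x \<alpha>)"
  have "diameter (slice ?f \<delta>) = 2"
    using LD2P norm_coordinate_functional[OF assms(2)] \<open>0 < \<delta>\<close> unfolding LD2P_def by blast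
  moreover have "diameter (slice ?f \<delta>) \<le> \<delta> + 2 * E_modulus ev \<alpha> \<epsilon>"
    using diameter_coordinate_slice_le[OF assms(2)] \<delta> by blast
  ultimately show False using \<delta> E by linarith
qed

end
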